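(* Let $n\ge 1$, let $\mathbb{F}\in\{\mathbb{R},\mathbb{C}\}$, let $V$ be an $n$-dimensional linear space over $\mathbb{F}$ with a scalar product $\langle\cdot,\cdot\rangle$, and let $f:V\to\mathbb{R}^+$ be a norm. Let $(b_1,\dots,b_n)$ and $(e_1,\dots,e_n)$ be orthonormal bases of $V$ such that $$f(b_1)\le f(b_2)\le\dots\le f(b_n)\quad\text{and}\quad f(e_1)\le f(e_2)\le\dots\le f(e_n).$$ Then the following hold for every $i\in\{1,\dots,n\}$. (1) If $(b_1,\dots,b_n)$ and $(e_1,\dots,e_n)$ are both $f$-minimal bases, then $$\frac{1}{\sqrt{i}}\le\frac{f(b_i)}{f(e_i)}\le\sqrt{i}.$$ (2) If $(b_1,\dots,b_n)$ is an $f$-minimal basis and $(e_1,\dots,e_n)$ is a rearrangement of an $f$-maximal basis, then $$\frac{1}{\sqrt{i}\,(2^{n-i+1}-1)}\le\frac{f(b_i)}{f(e_i)}\le\sqrt{i}.$$ (3) If $(b_1,\dots,b_n)$ and $(e_1,\dots,e_n)$ are both rearrangements of $f$-maximal bases, then $$\frac{1}{\sqrt{i}\,(2^{n-i+1}-1)}\le\frac{f(b_i)}{f(e_i)}\le\sqrt{i}\,(2^{n-i+1}-1).$$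
   Context: $\mathbb{R}^+$ denotes the non-negative reals, and $\mathbb{S}_1=\{u\in V:\langle u,u\rangle=1\}$. An $f$-minimal (resp. $f$-maximal) basis is an (ordered, orthonormal) basis of $V$ defined inductively on $n=\dim V$. If $n=1$, then $(b)$ is $f$-minimal (resp. $f$-maximal) for any $b\in\mathbb{S}_1$. If $n>1$, choose $b_1\in\arg\min\{f(b): b\in\mathbb{S}_1\}$ (resp. $b_1\in\arg\max\{f(b): b\in\mathbb{S}_1\}$), let $V_1=\{u\in V:\langle u,b_1\rangle=0\}$ and let $f_1=f\upharpoonright V_1$; if $(b_2,\dots,b_n)$ is an $f_1$-minimal (resp. $f_1$-maximal) basis of $V_1$, then $(b_1,b_2,\dots,b_n)$ is an $f$-minimal (resp. $f$-maximal) basis of $V$. A rearrangement of an ordered basis is the same collection of vectors listed in a possibly different order (an $f$-maximal basis, in its defining order, has non-increasing values of $f$, whereas here bases are listed so that the values of $f$ are non-decreasing). *)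

theory Defs
  imports Complex_Main "HOL-Library.Multiset"
begin

text \<open>
  The scalar field is the real or the complex field. The class covers both at once: the field
  embedding into the complex numbers has range exactly the reals or everything, so every type of
  the class is a copy of one of the two fields, and modulus and conjugation are read off through
  the embedding.
\<close>

class real_or_complex = field +
  fixes to_complex :: "'a \<Rightarrow> complex"
  assumes to_complex_add: "to_complex (x + y) = to_complex x + to_complex y"
    and to_complex_mult: "to_complex (x * y) = to_complex x * to_complex y"
    and to_complex_one: "to_complex 1 = 1"
    and range_to_complex: "range to_complex = \<real> \<or> range to_complex = UNIV"

instantiation real :: real_or_complex
begin

definition to_complex_real :: "real \<Rightarrow> complex"
  where "to_complex_real x = complex_of_real x"

instance
  by standard (auto simp: to_complex_real_def Reals_def)

end

instantiation complex :: real_or_complex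
begin

definition to_complex_complex :: "complex \<Rightarrow> complex"
  where "to_complex_complex z = z"

instance
  by standard (auto simp: to_complex_complex_def)

end

locale scalar_product_space = vector_space scale
  for scale :: "'k::real_or_complex \<Rightarrow> 'v::ab_group_add \<Rightarrow> 'v" +
  fixes ip :: "'v \<Rightarrow> 'v \<Rightarrow> 'k"
  assumes ip_add_left: "ip (u + v) w = ip u w + ip v w"
    and ip_scale_left: "ip (scale a u) w = a * ip u w"
    and ip_hermitian: "to_complex (ip u v) = cnj (to_complex (ip v u))"
      \<comment> \<open>in particular \<open>ip u u\<close> is real, so that its real part below is all of it\<close>
    and ip_pos: "u \<noteq> 0 \<Longrightarrow> 0 < Re (to_complex (ip u u))"
begin

definition norm_function :: "('v \<Rightarrow> real) \<Rightarrow> bool" where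
  "norm_function f \<longleftrightarrow>
     (\<forall>u. 0 \<le> f u) \<and>
     (\<forall>u. f u = 0 \<longleftrightarrow> u = 0) \<and>
     (\<forall>a u. f (scale a u) = cmod (to_complex a) * f u) \<and>
     (\<forall>u v. f (u + v) \<le> f u + f v)"

definition orthonormal_basis :: "'v list \<Rightarrow> bool" where
  "orthonormal_basis bs \<longleftrightarrow>
     distinct bs \<and> independent (set bs) \<and> span (set bs) = UNIV \<and>
     (\<forall>i<length bs. \<forall>j<length bs. ip (bs ! i) (bs ! j) = (if i = j then 1 else 0))"

definition unit_sphere :: "'v set \<Rightarrow> 'v set" where
  "unit_sphere V = {u \<in> V. ip u u = 1}"

text \<open>
  The recursion runs over subspaces \<open>V\<close> of the ambient space; restricting \<open>f\<close> to a subspace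
  amounts to evaluating it only there.
\<close>

inductive minimal_basis :: "('v \<Rightarrow> real) \<Rightarrow> 'v set \<Rightarrow> 'v list \<Rightarrow> bool"
  for f :: "'v \<Rightarrow> real" where
  singleton: "dim V = 1 \<Longrightarrow> b \<in> unit_sphere V \<Longrightarrow> minimal_basis f V [b]"
| step: "dim V > 1 \<Longrightarrow> is_arg_min f (\<lambda>b. b \<in> unit_sphere V) b \<Longrightarrow>
    minimal_basis f {u \<in> V. ip u b = 0} bs \<Longrightarrow> minimal_basis f V (b # bs)"

inductive maximal_basis :: "('v \<Rightarrow> real) \<Rightarrow> 'v set \<Rightarrow> 'v list \<Rightarrow> bool"
  for f :: "'v \<Rightarrow> real" where
  singleton: "dim V = 1 \<Longrightarrow> b \<in> unit_sphere V \<Longrightarrow> maximal_basis f V [b]"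
| step: "dim V > 1 \<Longrightarrow> is_arg_max f (\<lambda>b. b \<in> unit_sphere V) b \<Longrightarrow>
    maximal_basis f {u \<in> V. ip u b = 0} bs \<Longrightarrow> maximal_basis f V (b # bs)"

definition rearranged_maximal_basis :: "('v \<Rightarrow> real) \<Rightarrow> 'v set \<Rightarrow> 'v list \<Rightarrow> bool" where
  "rearranged_maximal_basis f V bs \<longleftrightarrow> (\<exists>cs. maximal_basis f V cs \<and> mset bs = mset cs)"

end

end

(* If (b_k) is f-minimal, b_i minimises f on the unit vectors orthogonal to b_1, ..., b_(i-1), and
   this subspace meets span (e_1, ..., e_i) for dimension reasons; on the latter f is at most
   sqrt i * f(e_i) times the Euclidean norm. If (m_1, ..., m_n) is f-maximal, then the coordinate
   functional <., m_j> on the j-th subspace of the recursion, multiplied by f(m_j), is dominated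
   by f (it is the norming functional of m_j). Peeling off the coordinates c_1, c_2, ... of a
   vector u one after another therefore at most doubles f each time, so that
   |c_j| f(m_j) <= 2^(j-1) f(u), and f(m_k) |u| <= (2^k - 1) f(u) on span (m_1, ..., m_k). This
   span meets span (b_1, ..., b_i) for k = n-i+1. *)

theory Submission imports Defs "HOL-Analysis.L2_Norm" begin

section \<open>The embedding of the scalar field into the complex numbers\<close>

lemma to_complex_zero [simp]: "to_complex (0 :: 'k::real_or_complex) = 0"
  using to_complex_add[of "0::'k" 0] by simp

lemma to_complex_minus: "to_complex (- x :: 'k::real_or_complex) = - to_complex x"
  using to_complex_add[of x "- x"] by (simp add: eq_neg_iff_add_eq_0 add.commute)

lemma to_complex_sum: "to_complex (sum g A :: 'k::real_or_complex) = (\<Sum>x\<in>A. to_complex (g x))"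
  by (induction A rule: infinite_finite_induct) (auto simp: to_complex_add)

text \<open>A nonzero element in the kernel would, multiplied by its inverse, give
  \<open>0 = 1\<close> in the complex numbers.\<close>

lemma to_complex_eq_0_iff [simp]: "to_complex (x :: 'k::real_or_complex) = 0 \<longleftrightarrow> x = 0"
proof
  assume x: "to_complex x = 0"
  show "x = 0"
  proof (rule ccontr)
    assume "x \<noteq> 0"
    then have "to_complex (x * inverse x) = 1"
      using to_complex_one by simp
    then show False using x by (simp add: to_complex_mult del: right_inverse)
  qed
qed simp

lemma to_complex_inject: "to_complex x = to_complex y \<longleftrightarrow> x = (y :: 'k::real_or_complex)"
  using to_complex_eq_0_iff[of "x - y"] to_complex_add[of x "- y"]
  by (metis diff_conv_add_uminus right_minus_eq to_complex_minus)

lemma ex_to_complex_of_real: "\<exists>a :: 'k::real_or_complex. to_complex a = complex_of_real r"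
  using range_to_complex[where 'a = 'k] by (metis Reals_of_real UNIV_I imageE)

section \<open>Scalar product and Euclidean norm\<close>

context scalar_product_space
begin

definition sqnorm :: "'v \<Rightarrow> real" where
  "sqnorm u = Re (to_complex (ip u u))"

definition coord :: "'v \<Rightarrow> 'v \<Rightarrow> real" where
  "coord u v = cmod (to_complex (ip u v))"

lemma ip_zero_left [simp]: "ip 0 v = 0"
  using ip_scale_left[of 0 0 v] by simp

lemma ip_minus_left: "ip (- u) v = - ip u v"
  using ip_scale_left[of "- 1" u v] by simp

lemma ip_diff_left: "ip (u - v) w = ip u w - ip v w"
  using ip_add_left[of u "- v" w] by (simp add: ip_minus_left)

lemma ip_sum_left: "ip (sum g A) w = (\<Sum>x\<in>A. ip (g x) w)"
  by (induction A rule: infinite_finite_induct) (auto simp: ip_add_left)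

lemma ip_eq_0_commute: "ip u v = 0 \<longleftrightarrow> ip v u = 0"
  by (metis complex_cnj_zero ip_hermitian to_complex_eq_0_iff to_complex_zero)

lemma to_complex_ip_add_right:
  "to_complex (ip u (v + w)) = to_complex (ip u v) + to_complex (ip u w)"
  by (metis complex_cnj_add ip_add_left ip_hermitian to_complex_add)

lemma to_complex_ip_scale_right:
  "to_complex (ip u (scale a v)) = cnj (to_complex a) * to_complex (ip u v)"
  by (metis complex_cnj_mult ip_hermitian ip_scale_left to_complex_mult)

lemma to_complex_ip_self: "to_complex (ip u u) = complex_of_real (sqnorm u)"
  using ip_hermitian[of u u] by (simp add: sqnorm_def complex_eq_iff)

lemma ip_self_eq_1_iff: "ip u u = 1 \<longleftrightarrow> sqnorm u = 1"
  by (metis of_real_eq_1_iff to_complex_inject to_complex_ip_self to_complex_one)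

lemma sqnorm_zero [simp]: "sqnorm 0 = 0"
  by (simp add: sqnorm_def)

lemma sqnorm_pos: "u \<noteq> 0 \<Longrightarrow> 0 < sqnorm u"
  using ip_pos by (simp add: sqnorm_def)

lemma sqnorm_nonneg: "0 \<le> sqnorm u"
  by (cases "u = 0") (auto dest: sqnorm_pos)

lemma ip_self_eq_0: "ip u u = 0 \<Longrightarrow> u = 0"
  using sqnorm_pos[of u] by (auto simp: sqnorm_def)

lemma sqnorm_scale: "sqnorm (scale a u) = (cmod (to_complex a))\<^sup>2 * sqnorm u"
proof -
  have "complex_of_real (sqnorm (scale a u))
      = (to_complex a * cnj (to_complex a)) * complex_of_real (sqnorm u)"
    unfolding to_complex_ip_self[symmetric]
    by (simp add: ip_scale_left to_complex_mult to_complex_ip_scale_right)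
  also have "\<dots> = complex_of_real ((cmod (to_complex a))\<^sup>2 * sqnorm u)"
    by (simp only: complex_norm_square[symmetric] of_real_mult)
  finally show ?thesis by (simp only: of_real_eq_iff)
qed

lemma sqnorm_add_orthogonal:
  assumes "ip u v = 0"
  shows "sqnorm (u + v) = sqnorm u + sqnorm v"
  using assms ip_eq_0_commute[of u v]
  by (simp add: sqnorm_def ip_add_left to_complex_add to_complex_ip_add_right)

lemma ex_normalized:
  assumes "u \<noteq> 0"
  obtains a where "cmod (to_complex a) = 1 / sqrt (sqnorm u)" "ip (scale a u) (scale a u) = 1"
proof -
  obtain a :: 'k where a: "to_complex a = complex_of_real (1 / sqrt (sqnorm u))"
    using ex_to_complex_of_real by blast
  have pos: "0 < sqnorm u" using assms by (rule sqnorm_pos)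
  have c: "cmod (to_complex a) = 1 / sqrt (sqnorm u)"
    unfolding a norm_of_real using pos by simp
  have "sqnorm (scale a u) = 1"
    unfolding sqnorm_scale c using pos by (simp add: power_divide)
  then show ?thesis using that c by (simp add: ip_self_eq_1_iff)
qed

section \<open>Orthogonality and dimension\<close>

lemma subspace_orthogonal:
  assumes "subspace V"
  shows "subspace {u \<in> V. ip u b = 0}"
  using assms by (auto simp: subspace_def ip_add_left ip_scale_left)

lemma subspace_orthogonal_all: "subspace {u. \<forall>x\<in>T. ip u x = 0}"
  by (auto simp: subspace_def ip_add_left ip_scale_left)

text \<open>If no such \<open>u\<close> existed, the linear map \<open>g\<close> below would be
  injective on \<open>span S\<close>, because independence of \<open>T\<close> makes its kernel
  exactly the vectors orthogonal to \<open>T\<close>. The image of \<open>S\<close> would then be an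
  independent set in \<open>span T\<close> with more than \<open>card T\<close> elements.\<close>

lemma ex_span_orthogonal:
  assumes "independent S" "finite T" "independent T" "card T < card S"
  obtains u where "u \<in> span S" "u \<noteq> 0" "\<And>t. t \<in> T \<Longrightarrow> ip u t = 0"
proof (rule ccontr)
  assume "\<not> thesis"
  with that have no: "u = 0" if "u \<in> span S" "\<And>t. t \<in> T \<Longrightarrow> ip u t = 0" for u
    using that by blast
  interpret P: vector_space_pair scale scale by unfold_locales
  define g where "g u = (\<Sum>t\<in>T. scale (ip u t) t)" for u
  have lin: "Vector_Spaces.linear scale scale g"
    by unfold_locales
      (simp_all add: g_def ip_add_left ip_scale_left scale_left_distrib sum.distrib scale_sum_right)
  have inj: "inj_on g (span S)"
  proof (subst P.linear_inj_on_iff_eq_0[OF lin subspace_span], intro ballI impI)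
    fix u assume u: "u \<in> span S" "g u = 0"
    then have "ip u t = 0" if "t \<in> T" for t
      using independentD[OF assms(3) assms(2) order_refl, of "ip u"] that by (simp add: g_def)
    then show "u = 0" using no u by blast
  qed
  have "independent (g ` S)"
    using P.linear_independent_injective_image[OF lin assms(1) inj] .
  moreover have "g ` S \<subseteq> span T"
    by (auto simp: g_def intro!: span_sum span_scale intro: span_base)
  ultimately have "card (g ` S) \<le> card T"
    using independent_span_bound[OF assms(2)] by blast
  moreover have "card (g ` S) = card S"
    using inj span_superset by (blast intro: card_image inj_on_subset)
  ultimately show False using assms(4) by simp
qed

section \<open>Coordinates in an orthonormal basis\<close>

text \<open>The remainder \<open>w\<close> is orthogonal to every basis vector, hence to the whole
  space and in particular to itself.\<close>

lemma orthonormal_basis_expand: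
  assumes "orthonormal_basis es"
  shows "u = (\<Sum>j<length es. scale (ip u (es ! j)) (es ! j))"
proof -
  define w where "w = u - (\<Sum>j<length es. scale (ip u (es ! j)) (es ! j))"
  have "ip w (es ! k) = 0" if "k < length es" for k
  proof -
    have "(\<Sum>j<length es. ip u (es ! j) * ip (es ! j) (es ! k))
        = (\<Sum>j<length es. if j = k then ip u (es ! k) else 0)"
      using assms that unfolding orthonormal_basis_def by (intro sum.cong) auto
    then show ?thesis
      using that by (simp add: w_def ip_diff_left ip_sum_left ip_scale_left)
  qed
  \<comment> \<open>Linearity is available in the first argument only, so \<open>w\<close> is moved
    to the second one before passing to the span.\<close>
  then have "set es \<subseteq> {v. \<forall>x\<in>{w}. ip v x = 0}"
    by (auto simp: in_set_conv_nth ip_eq_0_commute[of _ w])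
  then have "span (set es) \<subseteq> {v. \<forall>x\<in>{w}. ip v x = 0}"
    using subspace_orthogonal_all by (rule span_minimal)
  then have "ip w w = 0"
    using assms unfolding orthonormal_basis_def by auto
  then have "w = 0" by (rule ip_self_eq_0)
  then show ?thesis by (simp add: w_def)
qed

lemma orthonormal_basis_expand_initial:
  assumes "orthonormal_basis es" "k \<le> length es"
    and "\<And>j. k \<le> j \<Longrightarrow> j < length es \<Longrightarrow> ip u (es ! j) = 0"
  shows "u = (\<Sum>j<k. scale (ip u (es ! j)) (es ! j))"
proof -
  have "(\<Sum>j<length es. scale (ip u (es ! j)) (es ! j)) = (\<Sum>j<k. scale (ip u (es ! j)) (es ! j))"
    using assms by (intro sum.mono_neutral_right) auto
  then show ?thesis using orthonormal_basis_expand[OF assms(1), of u] by simp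
qed

text \<open>Parseval's identity, truncated where the coordinates vanish and written with
  \<open>L2_set\<close> for use with its inequalities.\<close>

lemma sqnorm_expand_initial:
  assumes "orthonormal_basis es" "k \<le> length es"
    and "\<And>j. k \<le> j \<Longrightarrow> j < length es \<Longrightarrow> ip u (es ! j) = 0"
  shows "sqrt (sqnorm u) = L2_set (\<lambda>j. coord u (es ! j)) {..<k}"
proof -
  have "complex_of_real (sqnorm u) = to_complex (ip u u)"
    by (simp add: to_complex_ip_self)
  also have "ip u u = (\<Sum>j<k. ip u (es ! j) * ip (es ! j) u)"
    using arg_cong[OF orthonormal_basis_expand_initial[OF assms], where f = "\<lambda>w. ip w u"]
    by (simp add: ip_sum_left ip_scale_left)
  also have "to_complex \<dots> = (\<Sum>j<k. to_complex (ip u (es ! j)) * cnj (to_complex (ip u (es ! j))))"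
    by (simp add: to_complex_sum to_complex_mult ip_hermitian[of _ u])
  also have "\<dots> = complex_of_real (\<Sum>j<k. (coord u (es ! j))\<^sup>2)"
    by (simp only: coord_def of_real_sum complex_norm_square)
  finally show ?thesis unfolding L2_set_def by (simp only: of_real_eq_iff)
qed

lemma orthonormal_basis_length: "orthonormal_basis es \<Longrightarrow> length es = dim (UNIV :: 'v set)"
  unfolding orthonormal_basis_def
  by (metis dim_eq_card_independent dim_span distinct_card)

lemma orthonormal_basis_independent:
  assumes "orthonormal_basis es" "S \<subseteq> set es"
  shows "independent S"
proof -
  have "independent (set es)" using assms(1) unfolding orthonormal_basis_def by simp
  then show ?thesis using assms(2) by (rule independent_mono)
qed

lemma orthonormal_basis_perm:
  assumes "orthonormal_basis es" "mset ms = mset es"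
  shows "orthonormal_basis ms"
proof -
  have d: "distinct ms" and s: "set ms = set es"
    using assms mset_eq_imp_distinct_iff mset_eq_setD unfolding orthonormal_basis_def by blast+
  have "ip x y = (if x = y then 1 else 0)" if "x \<in> set es" "y \<in> set es" for x y
    using that assms(1) unfolding orthonormal_basis_def in_set_conv_nth
    by (metis (no_types, lifting))
  then show ?thesis
    using assms(1) d s unfolding orthonormal_basis_def
    by (metis nth_eq_iff_index_eq nth_mem)
qed

section \<open>Upper bounds for a norm on spans of initial segments\<close>

lemma norm_function_zero: "norm_function f \<Longrightarrow> f 0 = 0"
  unfolding norm_function_def by blast

lemma norm_function_sum_le:
  assumes "norm_function f"
  shows "f (sum g A) \<le> (\<Sum>x\<in>A. f (g x))"
proof (induction A rule: infinite_finite_induct)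
  case (insert x F)
  have "f (g x + sum g F) \<le> f (g x) + f (sum g F)"
    using assms unfolding norm_function_def by blast
  with insert show ?case by simp
qed (simp_all add: norm_function_zero[OF assms])

text \<open>Triangle inequality, then Cauchy-Schwarz; sortedness lets the last value of
  \<open>f\<close> bound the earlier ones.\<close>

lemma norm_function_le_span_initial:
  assumes "norm_function f" "orthonormal_basis es" "sorted (map f es)"
    and i: "1 \<le> i" "i \<le> length es" and u: "u \<in> span (set (take i es))"
  shows "f u \<le> sqrt (real i) * f (es ! (i - 1)) * sqrt (sqnorm u)"
proof -
  have f: "\<And>u. 0 \<le> f u" "\<And>a u. f (scale a u) = cmod (to_complex a) * f u"
    using assms(1) unfolding norm_function_def by blast+
  have z: "ip u (es ! j) = 0" if "i \<le> j" "j < length es" for j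
  proof -
    have "set (take i es) \<subseteq> {v. \<forall>x\<in>{es ! j}. ip v x = 0}"
      using assms(2) that unfolding orthonormal_basis_def by (auto simp: in_set_conv_nth)
    then have "span (set (take i es)) \<subseteq> {v. \<forall>x\<in>{es ! j}. ip v x = 0}"
      using subspace_orthogonal_all by (rule span_minimal)
    then show ?thesis using u by auto
  qed
  have "f u = f (\<Sum>j<i. scale (ip u (es ! j)) (es ! j))"
    using orthonormal_basis_expand_initial[OF assms(2) i(2) z] by simp
  also have "\<dots> \<le> (\<Sum>j<i. f (scale (ip u (es ! j)) (es ! j)))"
    by (rule norm_function_sum_le[OF assms(1)])
  also have "\<dots> \<le> (\<Sum>j<i. \<bar>coord u (es ! j)\<bar> * \<bar>f (es ! (i - 1))\<bar>)"
  proof (rule sum_mono)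
    fix j assume "j \<in> {..<i}"
    then have "f (es ! j) \<le> f (es ! (i - 1))"
      using sorted_nth_mono[OF assms(3), of j "i - 1"] i by simp
    then show "f (scale (ip u (es ! j)) (es ! j)) \<le> \<bar>coord u (es ! j)\<bar> * \<bar>f (es ! (i - 1))\<bar>"
      using f by (simp add: coord_def mult_left_mono)
  qed
  \<comment> \<open>Cauchy-Schwarz; the second factor is the Euclidean length of a constant vector
    with \<open>i\<close> entries, which is where \<open>sqrt (real i)\<close> comes from.\<close>
  also have "\<dots> \<le> L2_set (\<lambda>j. coord u (es ! j)) {..<i} * L2_set (\<lambda>j. f (es ! (i - 1))) {..<i}"
    by (rule L2_set_mult_ineq)
  also have "\<dots> = sqrt (real i) * f (es ! (i - 1)) * sqrt (sqnorm u)"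
    using sqnorm_expand_initial[OF assms(2) i(2) z] f(1)
    by (simp add: L2_set_def real_sqrt_mult)
  finally show ?thesis .
qed

lemma norm_function_le_of_dim:
  assumes "norm_function f" "orthonormal_basis es" "sorted (map f es)"
    and i: "1 \<le> i" "i \<le> length es" and T: "finite T" "independent T" "card T < i"
  obtains u where "u \<noteq> 0" "\<And>t. t \<in> T \<Longrightarrow> ip u t = 0"
    "f u \<le> sqrt (real i) * f (es ! (i - 1)) * sqrt (sqnorm u)"
proof -
  have "independent (set (take i es))"
    using assms(2) set_take_subset by (rule orthonormal_basis_independent)
  moreover have "card (set (take i es)) = i"
    using assms(2) i unfolding orthonormal_basis_def by (simp add: distinct_card)
  ultimately obtain u where "u \<in> span (set (take i es))" "u \<noteq> 0" "\<And>t. t \<in> T \<Longrightarrow> ip u t = 0"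
    using ex_span_orthogonal[of "set (take i es)" T] T by auto
  then show ?thesis using that norm_function_le_span_initial[OF assms(1-3) i] by blast
qed

section \<open>Extremal property of minimal and maximal bases\<close>

text \<open>Unfolds the recursion: \<open>u\<close> is a competitor at the stage at which
  \<open>bs ! k\<close> is chosen. Of \<open>h\<close> only invariance under scalars of modulus 1 is
  asked, so that the lemma also applies to \<open>- f\<close> and thereby to maximal bases.\<close>

lemma minimal_basis_le:
  assumes "minimal_basis h V bs" "subspace V"
    and "\<And>a u. cmod (to_complex a) = 1 \<Longrightarrow> h (scale a u) = h u"
    and "k < length bs" "u \<in> V" "ip u u = 1" "\<And>j. j < k \<Longrightarrow> ip u (bs ! j) = 0"
  shows "h (bs ! k) \<le> h u"
  using assms
proof (induction arbitrary: k rule: minimal_basis.induct)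
  case (singleton V b)
  \<comment> \<open>At the last stage the vector is arbitrary on the unit sphere, but in dimension 1
    any two unit vectors differ by a scalar of modulus 1.\<close>
  obtain B where B: "B \<subseteq> V" "independent B" "V \<subseteq> span B" "card B = dim V"
    using basis_exists by blast
  then obtain x where "B = {x}" using singleton.hyps(1) by (metis card_1_singletonE)
  moreover have b: "b \<in> V" "ip b b = 1"
    using singleton.hyps(2) by (auto simp: unit_sphere_def)
  ultimately obtain p q where pq: "b = scale p x" "u = scale q x"
    using B(3) singleton.prems(4) by (metis span_breakdown_eq span_empty singletonD subsetD right_minus_eq)
  have "p \<noteq> 0" using pq b by auto
  then have u: "u = scale (q / p) b" using pq by simp
  then have "cmod (to_complex (q / p)) = 1"
    using b singleton.prems(5) sqnorm_scale[of "q / p" b]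
    by (simp add: ip_self_eq_1_iff power2_eq_1_iff) (smt (verit) norm_ge_zero)
  then have "h u = h b" using singleton.prems(2) u by simp
  then show ?case using singleton.prems(3) by simp
next
  case (step V b bs)
  show ?case
  proof (cases k)
    case 0
    then show ?thesis
      using step.hyps(2) step.prems(4,5) by (auto simp: is_arg_min_linorder unit_sphere_def)
  next
    case (Suc l)
    \<comment> \<open>Orthogonality to \<open>b\<close>, the instance \<open>j = 0\<close>, puts
      \<open>u\<close> into the next subspace; the other instances shift down by one.\<close>
    have "h (bs ! l) \<le> h u"
    proof (rule step.IH)
      show "subspace {u \<in> V. ip u b = 0}"
        using step.prems(1) by (rule subspace_orthogonal)
      show "u \<in> {u \<in> V. ip u b = 0}"
        using step.prems(4) step.prems(6)[of 0] Suc by simp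
      show "ip u (bs ! j) = 0" if "j < l" for j
        using step.prems(6)[of "Suc j"] that Suc by simp
    qed (use step.prems Suc in auto)
    then show ?thesis using Suc by simp
  qed
qed

lemma maximal_basis_imp_minimal_basis:
  "maximal_basis f V ms \<Longrightarrow> minimal_basis (\<lambda>u. - f u) V ms"
  by (induction rule: maximal_basis.induct)
    (auto intro!: minimal_basis.intros simp: is_arg_max_linorder is_arg_min_linorder)

lemma minimal_basis_le_scaled:
  assumes "minimal_basis f UNIV bs" "norm_function f"
    and "k < length bs" "\<And>j. j < k \<Longrightarrow> ip u (bs ! j) = 0"
  shows "f (bs ! k) * sqrt (sqnorm u) \<le> f u"
proof (cases "u = 0")
  case True
  then show ?thesis using assms(2) by (simp add: norm_function_zero)
next
  case False
  have f: "\<And>a u. f (scale a u) = cmod (to_complex a) * f u"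
    using assms(2) unfolding norm_function_def by blast
  obtain a where a: "cmod (to_complex a) = 1 / sqrt (sqnorm u)" "ip (scale a u) (scale a u) = 1"
    using ex_normalized[OF False] .
  have "f (bs ! k) \<le> f (scale a u)"
    using assms(3,4) a(2) by (intro minimal_basis_le[OF assms(1)]) (auto simp: f ip_scale_left)
  then show ?thesis using a(1) sqnorm_pos[OF False] by (simp add: f field_simps)
qed

lemma maximal_basis_ge_scaled:
  assumes "maximal_basis f UNIV ms" "norm_function f"
    and "k < length ms" "\<And>j. j < k \<Longrightarrow> ip u (ms ! j) = 0"
  shows "f u \<le> f (ms ! k) * sqrt (sqnorm u)"
proof (cases "u = 0")
  case True
  then show ?thesis using assms(2) by (simp add: norm_function_zero)
next
  case False
  have f: "\<And>a u. f (scale a u) = cmod (to_complex a) * f u"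
    using assms(2) unfolding norm_function_def by blast
  obtain a where a: "cmod (to_complex a) = 1 / sqrt (sqnorm u)" "ip (scale a u) (scale a u) = 1"
    using ex_normalized[OF False] .
  have "- f (ms ! k) \<le> - f (scale a u)"
    using assms(3,4) a(2)
    by (intro minimal_basis_le[OF maximal_basis_imp_minimal_basis[OF assms(1)]])
      (auto simp: f ip_scale_left)
  then show ?thesis using a(1) sqnorm_pos[OF False] by (simp add: f field_simps)
qed

section \<open>Coordinate estimates for maximal bases\<close>

text \<open>
  This replaces the norming functional of \<open>m\<close>: writing \<open>x = c m + w\<close> with \<open>w\<close> orthogonal to \<open>m\<close>,
  one has \<open>(1 + s) c m = s x + (c m - s w)\<close>, where the Euclidean norm of the last term
  exceeds \<open>\<bar>c\<bar>\<close> only to second order in \<open>s\<close>.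
\<close>

lemma coord_mult_le:
  assumes "norm_function f" "subspace V" "m \<in> V" "ip m m = 1" "x \<in> V"
    and max: "\<And>u. u \<in> V \<Longrightarrow> f u \<le> f m * sqrt (sqnorm u)"
  shows "coord x m * f m \<le> f x"
proof (cases "ip x m = 0")
  case True
  then show ?thesis using assms(1) by (simp add: coord_def norm_function_def)
next
  case False
  have f: "\<And>u. 0 \<le> f u" "\<And>a u. f (scale a u) = cmod (to_complex a) * f u"
    "\<And>u v. f (u + v) \<le> f u + f v"
    using assms(1) unfolding norm_function_def by blast+
  define c where "c = ip x m"
  define C where "C = coord x m"
  define w where "w = x - scale c m"
  \<comment> \<open>\<open>s\<^sup>2 * K\<close> is the error after multiplication by
    \<open>f m\<close>: it comes from bounding \<open>sqrt (C\<^sup>2 + d)\<close> by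
    \<open>C + d / (2 * C)\<close> with \<open>d = s\<^sup>2 * sqnorm w\<close>.\<close>
  define K where "K = f m * sqnorm w / (2 * C)"
  have C: "0 < C" using False by (simp add: C_def coord_def)
  have K: "0 \<le> K" using C f(1) sqnorm_nonneg by (simp add: K_def)
  have wV: "w \<in> V" using assms(2,3,5) by (simp add: w_def subspace_diff subspace_scale)
  have wm: "ip w m = 0" using assms(4) by (simp add: w_def c_def ip_diff_left ip_scale_left)
  have m1: "sqnorm m = 1" using assms(4) by (simp add: ip_self_eq_1_iff)
  have key: "C * f m \<le> f x + s * K" if "0 < s" for s
  proof -
    obtain t :: 'k where t: "to_complex t = complex_of_real s"
      using ex_to_complex_of_real by blast
    define y where "y = scale c m + scale (- t) w"
    have "ip (scale (- t) w) (scale c m) = 0"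
      by (metis ip_eq_0_commute ip_scale_left mult_zero_right wm)
    then have "ip (scale c m) (scale (- t) w) = 0" by (simp only: ip_eq_0_commute)
    then have "sqnorm y = C\<^sup>2 + s\<^sup>2 * sqnorm w"
      by (simp add: y_def sqnorm_add_orthogonal sqnorm_scale m1 t to_complex_minus C_def c_def coord_def
        del: scale_minus_left)
    also have "\<dots> \<le> (C + s\<^sup>2 * sqnorm w / (2 * C))\<^sup>2"
      using C by (simp add: power2_sum)
    finally have "sqrt (sqnorm y) \<le> C + s\<^sup>2 * sqnorm w / (2 * C)"
      using C sqnorm_nonneg by (intro real_le_lsqrt) auto
    moreover have "y \<in> V" using assms(2,3) wV by (simp add: y_def subspace_add subspace_scale subspace_diff)
    ultimately have fy: "f y \<le> f m * (C + s\<^sup>2 * sqnorm w / (2 * C))"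
      using max[of y] f(1)[of m] by (meson mult_left_mono order_trans)
    have "scale ((1 + t) * c) m = scale t x + y"
      by (simp add: y_def w_def scale_right_diff_distrib scale_left_distrib distrib_right)
    then have "f (scale ((1 + t) * c) m) \<le> f (scale t x) + f y" using f(3) by simp
    moreover have "cmod (to_complex ((1 + t) * c)) = (1 + s) * C"
    proof -
      have "to_complex (1 + t) = complex_of_real (1 + s)"
        by (simp add: to_complex_add to_complex_one t)
      then have "cmod (to_complex (1 + t)) = 1 + s"
        using that norm_of_real[of "1 + s", where 'a = complex] by simp
      then show ?thesis by (simp add: to_complex_mult norm_mult C_def c_def coord_def)
    qed
    ultimately have "(1 + s) * C * f m \<le> s * f x + f m * (C + s\<^sup>2 * sqnorm w / (2 * C))"
      using fy that by (simp add: f(2) t)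
    \<comment> \<open>The zeroth-order term \<open>C * f m\<close> cancels, and every remaining term
      carries a factor \<open>s\<close>.\<close>
    then have "s * (C * f m) \<le> s * (f x + s * K)"
      by (simp add: K_def algebra_simps power2_eq_square)
    then show ?thesis using that by simp
  qed
  show ?thesis unfolding C_def[symmetric]
  proof (rule field_le_epsilon)
    fix e :: real assume e: "0 < e"
    \<comment> \<open>The choice of \<open>s\<close>; adding 1 keeps the denominator positive when
      \<open>K = 0\<close>.\<close>
    have "e / (K + 1) * K \<le> e" using e K by (simp add: field_simps)
    then show "C * f m \<le> f x + e" using key[of "e / (K + 1)"] e K by simp
  qed
qed

lemma maximal_basis_mult_sqnorm_le:
  assumes "maximal_basis f UNIV ms" "orthonormal_basis ms" "norm_function f"
    and k: "k < length ms" and u: "\<And>j. k < j \<Longrightarrow> j < length ms \<Longrightarrow> ip u (ms ! j) = 0"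
  shows "f (ms ! k) * sqrt (sqnorm u) \<le> (2 ^ Suc k - 1) * f u"
proof -
  have f: "\<And>u. 0 \<le> f u" "\<And>a u. f (scale a u) = cmod (to_complex a) * f u"
    "\<And>u v. f (u + v) \<le> f u + f v"
    using assms(3) unfolding norm_function_def by blast+
  have on: "ip (ms ! i) (ms ! j) = (if i = j then 1 else 0)" if "i < length ms" "j < length ms" for i j
    using assms(2) that unfolding orthonormal_basis_def by blast
  \<comment> \<open>\<open>v j\<close> is \<open>u\<close> with its first \<open>j\<close>
    coordinates removed: it starts at \<open>v 0 = u\<close>, lies in the subspace from which
    \<open>ms ! j\<close> is chosen, and keeps the later coordinates of \<open>u\<close>.\<close>
  define v where "v j = u - (\<Sum>l<j. scale (ip u (ms ! l)) (ms ! l))" for j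
  have ipv: "ip (v j) (ms ! i) = (if i < j then 0 else ip u (ms ! i))"
    if "j \<le> length ms" "i < length ms" for i j
  proof -
    have "(\<Sum>l<j. ip u (ms ! l) * ip (ms ! l) (ms ! i)) = (\<Sum>l<j. if l = i then ip u (ms ! i) else 0)"
      using on that by (intro sum.cong) auto
    then show ?thesis by (simp add: v_def ip_diff_left ip_sum_left ip_scale_left)
  qed
  have coord: "coord u (ms ! j) * f (ms ! j) \<le> f (v j)" if j: "j < length ms" for j
  proof -
    let ?V = "{w. \<forall>x\<in>{ms ! l |l. l < j}. ip w x = 0}"
    have "coord (v j) (ms ! j) * f (ms ! j) \<le> f (v j)"
    proof (rule coord_mult_le[OF assms(3), of ?V])
      show "f w \<le> f (ms ! j) * sqrt (sqnorm w)" if "w \<in> ?V" for w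
        using that by (intro maximal_basis_ge_scaled[OF assms(1,3) j]) auto
      show "ms ! j \<in> ?V" "v j \<in> ?V" "ip (ms ! j) (ms ! j) = 1"
        using on j ipv by auto
    qed (rule subspace_orthogonal_all)
    then show ?thesis using ipv j by (simp add: coord_def)
  qed
  have fv: "f (v j) \<le> 2 ^ j * f u" if "j \<le> length ms" for j
    using that
  proof (induction j)
    case (Suc j)
    have "v (Suc j) = v j + scale (- ip u (ms ! j)) (ms ! j)"
      by (simp add: v_def algebra_simps)
    then have "f (v (Suc j)) \<le> f (v j) + coord u (ms ! j) * f (ms ! j)"
      using f(3)[of "v j" "scale (- ip u (ms ! j)) (ms ! j)"]
      by (simp add: f(2) coord_def to_complex_minus del: scale_minus_left)
    also have "\<dots> \<le> 2 * f (v j)" using coord[of j] Suc.prems by simp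
    also have "\<dots> \<le> 2 ^ Suc j * f u" using Suc by simp
    finally show ?case .
  qed (simp add: v_def)
  have "f (ms ! k) * sqrt (sqnorm u) = f (ms ! k) * L2_set (\<lambda>j. coord u (ms ! j)) {..<Suc k}"
    by (subst sqnorm_expand_initial[OF assms(2), of "Suc k"]) (use k u in auto)
  \<comment> \<open>The Euclidean norm is at most the sum of the moduli of the coordinates, of which
    only the first \<open>Suc k\<close> can be nonzero.\<close>
  also have "\<dots> \<le> f (ms ! k) * (\<Sum>j<Suc k. coord u (ms ! j))"
    using f(1) by (intro mult_left_mono L2_set_le_sum) (auto simp: coord_def)
  also have "\<dots> = (\<Sum>j<Suc k. coord u (ms ! j) * f (ms ! k))"
    by (simp only: sum_distrib_left mult.commute)
  also have "\<dots> \<le> (\<Sum>j<Suc k. 2 ^ j * f u)"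
  proof (rule sum_mono)
    fix j assume j: "j \<in> {..<Suc k}"
    \<comment> \<open>\<open>ms ! k\<close> is itself a competitor at stage \<open>j\<close>, so
      \<open>f (ms ! k)\<close> may be replaced by the larger \<open>f (ms ! j)\<close>, for which
      \<open>coord\<close> applies. The bounds then add up to a geometric sum.\<close>
    have "f (ms ! k) \<le> f (ms ! j) * sqrt (sqnorm (ms ! k))"
      using j k on by (intro maximal_basis_ge_scaled[OF assms(1,3)]) auto
    moreover have "sqnorm (ms ! k) = 1"
      using on k by (simp flip: ip_self_eq_1_iff)
    ultimately have "coord u (ms ! j) * f (ms ! k) \<le> coord u (ms ! j) * f (ms ! j)"
      by (simp add: coord_def mult_left_mono)
    also have "\<dots> \<le> f (v j)" using coord j k by simp
    also have "\<dots> \<le> 2 ^ j * f u" using fv j k by simp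
    finally show "coord u (ms ! j) * f (ms ! k) \<le> 2 ^ j * f u" .
  qed
  also have "\<dots> = (\<Sum>j<Suc k. 2 ^ j) * f u" by (rule sum_distrib_right[symmetric])
  also have "(\<Sum>j<Suc k. 2 ^ j) = (2 ^ Suc k - 1 :: real)"
    using power_diff_1_eq[of "2::real" "Suc k"] by simp
  finally show ?thesis .
qed

lemma maximal_basis_sorted:
  assumes "maximal_basis f UNIV ms" "orthonormal_basis ms" "norm_function f"
  shows "sorted (map f (rev ms))"
proof -
  have "f (ms ! k) \<le> f (ms ! j)" if "j \<le> k" "k < length ms" for j k
  proof -
    have "ip (ms ! k) (ms ! i) = (if k = i then 1 else 0)" if "i < length ms" for i
      using assms(2) that \<open>k < length ms\<close> unfolding orthonormal_basis_def by blast
    then show ?thesis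
      using maximal_basis_ge_scaled[OF assms(1,3), of j "ms ! k"] that ip_self_eq_1_iff[of "ms ! k"] by simp
  qed
  then show ?thesis by (simp add: rev_map[symmetric] sorted_rev_iff_nth_mono)
qed

section \<open>Comparison of two bases\<close>

lemma minimal_basis_ratio_le:
  assumes "minimal_basis f UNIV bs" "orthonormal_basis bs"
    and "norm_function f" "orthonormal_basis es" "sorted (map f es)"
    and i: "1 \<le> i" "i \<le> dim (UNIV :: 'v set)"
  shows "f (bs ! (i - 1)) \<le> sqrt (real i) * f (es ! (i - 1))"
proof -
  have len: "length bs = dim (UNIV :: 'v set)" "length es = dim (UNIV :: 'v set)"
    using assms(2,4) by (simp_all add: orthonormal_basis_length)
  \<comment> \<open>The \<open>i - 1\<close> vectors chosen before \<open>bs ! (i - 1)\<close>: one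
    fewer than the dimension of the span of the first \<open>i\<close> vectors of
    \<open>es\<close>.\<close>
  let ?T = "set (take (i - 1) bs)"
  have "independent ?T"
    using assms(2) set_take_subset by (rule orthonormal_basis_independent)
  moreover have "card ?T < i"
    using card_length[of "take (i - 1) bs"] i len(1) by simp
  moreover have "i \<le> length es" using i(2) len(2) by simp
  ultimately obtain u where u: "u \<noteq> 0" "\<And>t. t \<in> ?T \<Longrightarrow> ip u t = 0"
    "f u \<le> sqrt (real i) * f (es ! (i - 1)) * sqrt (sqnorm u)"
    using norm_function_le_of_dim[OF assms(3-5) i(1) _ finite_set] by blast
  have "ip u (bs ! j) = 0" if "j < i - 1" for j
  proof (rule u(2))
    have "take (i - 1) bs ! j = bs ! j" using that by simp
    moreover have "j < length (take (i - 1) bs)" using that i(2) len(1) by simp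
    ultimately show "bs ! j \<in> ?T" by (metis nth_mem)
  qed
  then have "f (bs ! (i - 1)) * sqrt (sqnorm u) \<le> f u"
    using i len by (intro minimal_basis_le_scaled[OF assms(1,3)]) auto
  then have "f (bs ! (i - 1)) * sqrt (sqnorm u) \<le> sqrt (real i) * f (es ! (i - 1)) * sqrt (sqnorm u)"
    using u(3) by linarith
  then show ?thesis using sqnorm_pos[OF u(1)] by simp
qed

lemma rearranged_maximal_basis_ratio_le:
  assumes "rearranged_maximal_basis f UNIV bs" "orthonormal_basis bs" "sorted (map f bs)"
    and "norm_function f" "orthonormal_basis es" "sorted (map f es)"
    and i: "1 \<le> i" "i \<le> n" and n: "n = dim (UNIV :: 'v set)"
  shows "f (bs ! (i - 1)) \<le> sqrt (real i) * (2 ^ (n - i + 1) - 1) * f (es ! (i - 1))"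
proof -
  obtain ms where ms: "maximal_basis f UNIV ms" "mset bs = mset ms"
    using assms(1) unfolding rearranged_maximal_basis_def by blast
  have oms: "orthonormal_basis ms" using orthonormal_basis_perm[OF assms(2)] ms(2) by simp
  have len: "length bs = n" "length es = n" "length ms = n"
    using assms(2,5) oms n by (simp_all add: orthonormal_basis_length)
  \<comment> \<open>With ties \<open>bs\<close> need not be \<open>rev ms\<close>, but both lists of
    values are sorted and have the same multiset, so they agree.\<close>
  have "map f bs = map f (rev ms)"
    using maximal_basis_sorted[OF ms(1) oms assms(4)] assms(3) ms(2)
    by (metis mset_map mset_rev properties_for_sort)
  then have "map f bs ! (i - 1) = map f (rev ms) ! (i - 1)" by simp
  then have bm: "f (bs ! (i - 1)) = f (ms ! (n - i))"
    using i len by (simp add: rev_nth)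
  \<comment> \<open>The last \<open>i - 1\<close> vectors of \<open>ms\<close>. A vector orthogonal
    to them has coordinates only up to index \<open>n - i\<close>, counted from 0, hence the
    exponent \<open>Suc (n - i)\<close>.\<close>
  let ?T = "set (drop (n - i + 1) ms)"
  have "independent ?T"
    using oms set_drop_subset by (rule orthonormal_basis_independent)
  moreover have "card ?T < i"
    using card_length[of "drop (n - i + 1) ms"] i len(3) by simp
  moreover have "i \<le> length es" using i(2) len(2) by simp
  ultimately obtain u where u: "u \<noteq> 0" "\<And>t. t \<in> ?T \<Longrightarrow> ip u t = 0"
    "f u \<le> sqrt (real i) * f (es ! (i - 1)) * sqrt (sqnorm u)"
    using norm_function_le_of_dim[OF assms(4-6) i(1) _ finite_set] by blast
  have "ip u (ms ! j) = 0" if "n - i < j" "j < length ms" for j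
  proof (rule u(2))
    have "drop (n - i + 1) ms ! (j - (n - i + 1)) = ms ! j" using that by simp
    moreover have "j - (n - i + 1) < length (drop (n - i + 1) ms)" using that by simp
    ultimately show "ms ! j \<in> ?T" by (metis nth_mem)
  qed
  then have "f (ms ! (n - i)) * sqrt (sqnorm u) \<le> (2 ^ Suc (n - i) - 1) * f u"
    using i len by (intro maximal_basis_mult_sqnorm_le[OF ms(1) oms assms(4)]) auto
  also have "\<dots> \<le> (2 ^ Suc (n - i) - 1) * (sqrt (real i) * f (es ! (i - 1)) * sqrt (sqnorm u))"
  proof (rule mult_left_mono[OF u(3)])
    have "(1::real) \<le> 2 ^ Suc (n - i)" by (rule one_le_power) simp
    then show "(0::real) \<le> 2 ^ Suc (n - i) - 1" by simp
  qed
  finally have "f (bs ! (i - 1)) * sqrt (sqnorm u)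
      \<le> (sqrt (real i) * (2 ^ (n - i + 1) - 1) * f (es ! (i - 1))) * sqrt (sqnorm u)"
    unfolding bm by (simp add: mult_ac)
  then show ?thesis using sqnorm_pos[OF u(1)] by simp
qed

lemma orthonormal_basis_norm_pos:
  assumes "norm_function f" "orthonormal_basis es" "j < length es"
  shows "0 < f (es ! j)"
proof -
  have "ip (es ! j) (es ! j) = 1"
    using assms(2,3) unfolding orthonormal_basis_def by simp
  then have "es ! j \<noteq> 0" by (metis ip_zero_left zero_neq_one)
  then show ?thesis using assms(1) unfolding norm_function_def by (metis less_eq_real_def)
qed

end

theorem corollary10:
  fixes scale :: "'k::real_or_complex \<Rightarrow> 'v::ab_group_add \<Rightarrow> 'v"
    and ip :: "'v \<Rightarrow> 'v \<Rightarrow> 'k"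
    and f :: "'v \<Rightarrow> real"
    and bs es :: "'v list"
    and n i :: nat
  assumes "scalar_product_space scale ip"
    and "n \<ge> 1"
    and "vector_space.dim scale (UNIV :: 'v set) = n"
    and "scalar_product_space.norm_function scale f"
    and "scalar_product_space.orthonormal_basis scale ip bs"
    and "scalar_product_space.orthonormal_basis scale ip es"
    and "sorted (map f bs)"
    and "sorted (map f es)"
    and "i \<in> {1..n}"
  shows
    "(scalar_product_space.minimal_basis scale ip f UNIV bs \<and>
      scalar_product_space.minimal_basis scale ip f UNIV es \<longrightarrow>
        1 / sqrt (real i) \<le> f (bs ! (i - 1)) / f (es ! (i - 1)) \<and>
        f (bs ! (i - 1)) / f (es ! (i - 1)) \<le> sqrt (real i)) \<and>
     (scalar_product_space.minimal_basis scale ip f UNIV bs \<and>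
      scalar_product_space.rearranged_maximal_basis scale ip f UNIV es \<longrightarrow>
        1 / (sqrt (real i) * (2 ^ (n - i + 1) - 1)) \<le> f (bs ! (i - 1)) / f (es ! (i - 1)) \<and>
        f (bs ! (i - 1)) / f (es ! (i - 1)) \<le> sqrt (real i)) \<and>
     (scalar_product_space.rearranged_maximal_basis scale ip f UNIV bs \<and>
      scalar_product_space.rearranged_maximal_basis scale ip f UNIV es \<longrightarrow>
        1 / (sqrt (real i) * (2 ^ (n - i + 1) - 1)) \<le> f (bs ! (i - 1)) / f (es ! (i - 1)) \<and>
        f (bs ! (i - 1)) / f (es ! (i - 1)) \<le> sqrt (real i) * (2 ^ (n - i + 1) - 1))"
proof -
  interpret scalar_product_space scale ip by fact
  have i: "1 \<le> i" "i \<le> n" "i \<le> dim (UNIV :: 'v set)" and n: "n = dim (UNIV :: 'v set)"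
    using assms(3,9) by auto
  have pos: "0 < f (bs ! (i - 1))" "0 < f (es ! (i - 1))"
    using assms(4-6) i by (auto intro!: orthonormal_basis_norm_pos simp: orthonormal_basis_length)
  \<comment> \<open>The exponent is at least 1, so the factor \<open>2 ^ (n - i + 1) - 1\<close> is
    positive and may be divided by.\<close>
  have "(1::real) < 2 ^ (n - i + 1)" by (rule one_less_power) auto
  moreover have "0 < sqrt (real i)" using i by simp
  ultimately have q: "0 < sqrt (real i)" "0 < sqrt (real i) * (2 ^ (n - i + 1) - 1)"
    by (simp_all only: zero_less_mult_iff diff_gt_0_iff_gt simp_thms)
  have upper: "x / y \<le> c" if "x \<le> c * y" "0 < y" for x y c :: real
    using that by (simp add: pos_divide_le_eq)
  have lower: "1 / c \<le> x / y" if "y \<le> c * x" "0 < y" "0 < c" for x y c :: real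
    using that by (simp add: field_simps)
  \<comment> \<open>Upper bounds use these with \<open>bs\<close> as the extremal basis; lower
    bounds are the same inequalities with \<open>bs\<close> and \<open>es\<close> exchanged.\<close>
  note minimal = minimal_basis_ratio_le[OF _ _ assms(4) _ _ i(1,3)]
  note maximal = rearranged_maximal_basis_ratio_le[OF _ _ _ assms(4) _ _ i(1,2) n]
  show ?thesis
    using assms(5-8) pos q by (intro conjI impI; elim conjE) (blast intro: upper lower minimal maximal)+
qed

end
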